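(* Let $n$ be a positive integer and consider the following system of polynomial equations over $\mathbb{R}$ in the variables $\{x_{ij}: 1 \le i < j \le n\}$ (with the convention $x_{ji} = x_{ij}$ for $i<j$): (1) $x_{ij}^2 - x_{ij} = 0$ for all $1 \le i < j \le n$; (2) $\sum_{j \in [1,n],\, j \neq i} x_{ij} - 1 = 0$ for all $i \in [1,n]$. Then degree $\frac{n-1}{2}$ SOS fails to prove that this system is infeasible; that is, there is no identity $-1 = \sum_i f_i s_i + \sum_j g_j^2$, where the $s_i$ range over the left-hand sides of the equations above and $f_i, g_j$ are real polynomials, with $\deg(f_i) + \deg(s_i) \le \frac{n-1}{2}$ for all $i$ and $\deg(g_j) \le \frac{n-1}{4}$ for all $j$.
   Context: The system expresses that the complete graph $K_n$ has a perfect matching ($x_{ij}=1$ iff edge $\{i,j\}$ is in the matching). Degree refers to ordinary total polynomial degree. A degree $d$ SOS (Positivstellensatz) refutation of a system $\{s_i = 0\}$ is an identity $-1 = \sum_i f_i s_i + \sum_j g_j^2$ with $\deg(f_i)+\deg(s_i) \le d$ and $\deg(g_j) \le d/2$.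
   Formalization: The formal theorem assumes n ≥ 2 instead of n a positive integer; for n = 1 the claim is false, since the system is the single equation −1 = 0 and −1 = 1·(−1) is a refutation of degree 0 = (n−1)/2. *)

theory Defs
  imports Complex_Main "HOL-Library.Poly_Mapping" "HOL-Library.Extended_Real"
begin

text \<open>
  Real multivariate polynomials as finitely supported functions from monomials (exponent
  vectors) to coefficients; \<open>(*)\<close> on \<^type>\<open>poly_mapping\<close> is convolution, i.e. the usual product.
\<close>

type_synonym 'v rpoly = "('v \<Rightarrow>\<^sub>0 nat) \<Rightarrow>\<^sub>0 real"

definition Var :: "'v \<Rightarrow> 'v rpoly" where
  "Var v = Poly_Mapping.single (Poly_Mapping.single v 1) 1"

definition mdeg :: "('v \<Rightarrow>\<^sub>0 nat) \<Rightarrow> nat" where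
  "mdeg m = (\<Sum>v\<in>Poly_Mapping.keys m. Poly_Mapping.lookup m v)"

text \<open>
  The total degree takes values in \<^typ>\<open>ereal\<close> so that the zero polynomial has degree
  \<open>-\<infinity>\<close> (the supremum of the empty set). Hence a multiplier \<open>f = 0\<close> meets every
  degree bound in a refutation.
\<close>

definition tdeg :: "'v rpoly \<Rightarrow> ereal" where
  "tdeg p = (SUP m\<in>Poly_Mapping.keys p. ereal (real (mdeg m)))"

definition polys_in :: "'v set \<Rightarrow> 'v rpoly set" where
  "polys_in V = {p. \<forall>m\<in>Poly_Mapping.keys p. Poly_Mapping.keys m \<subseteq> V}"

text \<open>
  A degree \<open>d\<close> SOS (Positivstellensatz) refutation, with polynomials in the variables \<open>V\<close>, of
  the system \<open>s i = 0\<close> for \<open>i \<in> I\<close>, where \<open>I\<close> is finite; the list \<open>gs\<close> holds the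
  polynomials whose squares are summed.
\<close>

definition sos_refutable :: "'v set \<Rightarrow> 'i set \<Rightarrow> ('i \<Rightarrow> 'v rpoly) \<Rightarrow> real \<Rightarrow> bool" where
  "sos_refutable V I s d \<longleftrightarrow>
     (\<exists>(f :: 'i \<Rightarrow> 'v rpoly) (gs :: 'v rpoly list).
        (\<forall>i\<in>I. f i \<in> polys_in V \<and> tdeg (f i) + tdeg (s i) \<le> ereal d) \<and>
        (\<forall>g\<in>set gs. g \<in> polys_in V \<and> tdeg g \<le> ereal (d / 2)) \<and>
        - 1 = (\<Sum>i\<in>I. f i * s i) + (\<Sum>g\<leftarrow>gs. g ^ 2))"

definition edges :: "nat \<Rightarrow> (nat \<times> nat) set" where
  "edges n = {(i, j). 1 \<le> i \<and> i < j \<and> j \<le> n}"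

text \<open>The use of \<^const>\<open>min\<close> and \<^const>\<open>max\<close> implements the convention \<open>xvar j i = xvar i j\<close>.\<close>

definition xvar :: "nat \<Rightarrow> nat \<Rightarrow> (nat \<times> nat) rpoly" where
  "xvar i j = Var (min i j, max i j)"

text \<open>
  The perfect matching system of \<open>K\<^sub>n\<close>: an index \<open>Inl (i, j)\<close> stands for the Boolean
  equation of an edge, an index \<open>Inr i\<close> for the equation of a vertex.
\<close>

definition pm_index :: "nat \<Rightarrow> ((nat \<times> nat) + nat) set" where
  "pm_index n = edges n <+> {1..n}"

fun pm_eqn :: "nat \<Rightarrow> (nat \<times> nat) + nat \<Rightarrow> (nat \<times> nat) rpoly" where
  "pm_eqn n (Inl (i, j)) = xvar i j ^ 2 - xvar i j"
| "pm_eqn n (Inr i) = (\<Sum>j\<in>{1..n} - {i}. xvar i j) - 1"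

text \<open>
  For \<open>n = 1\<close> the only equation is \<open>-1 = 0\<close>, whose left-hand side has degree \<open>0\<close>, so the
  system has a refutation of degree \<open>(n - 1) / 2 = 0\<close>. The lower bound can only hold
  from \<open>n = 2\<close> on.
\<close>

lemma sos_refutable_pm_one:
  "sos_refutable (edges 1) (pm_index 1) (pm_eqn 1) ((real 1 - 1) / 2)"
proof -
  have I: "pm_index 1 = {Inr 1}"
    by (auto simp: pm_index_def edges_def)
  have E: "pm_eqn 1 (Inr 1) = - 1"
    by simp
  have k: "Poly_Mapping.keys (- 1 :: (nat \<times> nat) rpoly) = {0}"
    by (auto simp: set_eq_iff in_keys_iff lookup_one)
  have "tdeg (1 :: (nat \<times> nat) rpoly) = 0" "tdeg (- 1 :: (nat \<times> nat) rpoly) = 0"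
    by (simp_all add: tdeg_def k mdeg_def)
  then show ?thesis
    unfolding sos_refutable_def I
    by (intro exI[of _ "\<lambda>_. 1"] exI[of _ "[]"]) (simp add: E polys_in_def)
qed

end

theory Submission
  imports Defs "HOL-Combinatorics.Permutations"
begin

text \<open>
  If \<open>k\<close> edges form a matching, a uniformly random perfect matching of \<open>K\<^sub>n\<close>, \<open>n\<close> even, contains
  them with probability \<open>1 / ((n - 1) (n - 3) \<dots> (n - 2 k + 1))\<close>. For every \<open>n\<close>, using this number as
  the value of the product of the \<open>k\<close> variables (and \<open>0\<close> for edges that are not a matching) gives a
  linear functional that satisfies the equations up to degree \<open>(n - 1) / 2\<close>. A refutation is
  impossible if this functional is nonnegative on the squares that may occur in it.

  Let \<open>- c\<close> be a lower bound for the quadratic form relative to the Euclidean norm. Averaging a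
  vector over the permutations that fix the vertices of the matching at its largest coordinate keeps
  that coordinate and does not increase the form plus \<open>c\<close> times the norm. If the form is nonnegative
  on averaged vectors, \<open>c\<close> can be replaced by \<open>c (1 - 1 / N)\<close>, hence by \<open>0\<close> in the limit. An averaged
  vector is symmetric outside a set \<open>J\<close> of at most \<open>n / 2\<close> vertices, and the vertex equations
  rewrite it in terms of the edges inside \<open>J\<close>. There the functional is a genuine expectation: the
  vertices of \<open>J\<close> successively choose their partners at random.
\<close>

subsection \<open>Positive semidefinite forms\<close>

definition psd_on :: "'a set \<Rightarrow> ('a \<Rightarrow> 'a \<Rightarrow> real) \<Rightarrow> bool" where
  "psd_on X K \<longleftrightarrow> (\<forall>v. 0 \<le> (\<Sum>a\<in>X. \<Sum>b\<in>X. v a * v b * K a b))"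

lemma psd_onD: "psd_on X K \<Longrightarrow> 0 \<le> (\<Sum>a\<in>X. \<Sum>b\<in>X. v a * v b * K a b)"
  by (simp add: psd_on_def)

text \<open>Only the fibre sums of \<open>h\<close> enter the form, so \<open>f\<close> may be
  non-injective: later, several monomials share one edge set.\<close>

lemma quadratic_form_regroup:
  fixes h :: "'a \<Rightarrow> real"
  assumes "finite S" "finite X" "f ` S \<subseteq> X"
  shows "(\<Sum>a\<in>S. \<Sum>b\<in>S. h a * h b * K (f a) (f b)) =
    (\<Sum>x\<in>X. \<Sum>y\<in>X. (\<Sum>a\<in>{a\<in>S. f a = x}. h a) * (\<Sum>b\<in>{b\<in>S. f b = y}. h b) * K x y)"
proof -
  have inner: "(\<Sum>b\<in>S. c * h b * G (f b)) = (\<Sum>y\<in>X. c * (\<Sum>b\<in>{b\<in>S. f b = y}. h b) * G y)" for c G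
    by (subst sum.group [OF assms, symmetric])
      (auto simp: sum_distrib_left sum_distrib_right intro!: sum.cong)
  have "(\<Sum>a\<in>S. \<Sum>b\<in>S. h a * h b * K (f a) (f b)) =
    (\<Sum>a\<in>S. \<Sum>y\<in>X. h a * (\<Sum>b\<in>{b\<in>S. f b = y}. h b) * K (f a) y)"
    by (simp add: inner)
  also have "\<dots> = (\<Sum>y\<in>X. (\<Sum>b\<in>{b\<in>S. f b = y}. h b) * (\<Sum>a\<in>S. 1 * h a * K (f a) y))"
    unfolding sum_distrib_left[of _ _ S] by (subst sum.swap) (simp add: mult_ac)
  also have "\<dots> = (\<Sum>y\<in>X. (\<Sum>b\<in>{b\<in>S. f b = y}. h b) *
      (\<Sum>x\<in>X. (\<Sum>a\<in>{a\<in>S. f a = x}. h a) * K x y))"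
    by (subst inner[of 1]) simp
  also have "\<dots> = (\<Sum>x\<in>X. \<Sum>y\<in>X. (\<Sum>a\<in>{a\<in>S. f a = x}. h a) * (\<Sum>b\<in>{b\<in>S. f b = y}. h b) * K x y)"
    unfolding sum_distrib_left[of _ _ X] by (subst sum.swap) (simp add: mult_ac)
  finally show ?thesis .
qed

lemma psd_on_vimage:
  assumes "finite S" "finite X" "f ` S \<subseteq> X" "psd_on X K"
  shows "psd_on S (\<lambda>a b. K (f a) (f b))"
  unfolding psd_on_def quadratic_form_regroup[OF assms(1-3)]
  by (rule allI) (rule psd_onD[OF assms(4)])

lemma psd_on_add:
  assumes "psd_on X K" "psd_on X L"
  shows "psd_on X (\<lambda>a b. K a b + L a b)"
  using assms by (simp add: psd_on_def distrib_left sum.distrib add_nonneg_nonneg)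

lemma psd_on_scale:
  assumes "psd_on X K" "0 \<le> c"
  shows "psd_on X (\<lambda>a b. c * K a b)"
proof -
  have "(\<Sum>a\<in>X. \<Sum>b\<in>X. v a * v b * (c * K a b)) = c * (\<Sum>a\<in>X. \<Sum>b\<in>X. v a * v b * K a b)" for v
    by (simp add: sum_distrib_left mult_ac)
  then show ?thesis
    using assms by (simp add: psd_on_def)
qed

lemma psd_on_sum:
  assumes "\<And>i. i \<in> I \<Longrightarrow> psd_on X (K i)"
  shows "psd_on X (\<lambda>a b. \<Sum>i\<in>I. K i a b)"
  using assms
proof (induction I rule: infinite_finite_induct)
  case (insert i I)
  then show ?case
    by (simp add: psd_on_add)
qed (simp_all add: psd_on_def)

text \<open>Invariance gives every permuted copy of \<open>v\<close> the same form value. The mean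
  of the form over the deviations from \<open>w\<close> is then a variance, the value at
  \<open>v\<close> minus the value at \<open>w\<close>, and it is nonnegative because the form
  is.\<close>

lemma quadratic_form_average:
  fixes K :: "'a \<Rightarrow> 'a \<Rightarrow> real" and v :: "'a \<Rightarrow> real" and r :: "'g \<Rightarrow> 'a \<Rightarrow> 'a"
  assumes "finite H" "H \<noteq> {}" and psd: "psd_on X K"
    and sym: "\<And>a b. a \<in> X \<Longrightarrow> b \<in> X \<Longrightarrow> K a b = K b a"
    and bij: "\<And>\<pi>. \<pi> \<in> H \<Longrightarrow> bij_betw (r \<pi>) X X"
    and inv: "\<And>\<pi> a b. \<pi> \<in> H \<Longrightarrow> a \<in> X \<Longrightarrow> b \<in> X \<Longrightarrow> K (r \<pi> a) (r \<pi> b) = K a b"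
  defines "w \<equiv> \<lambda>a. (\<Sum>\<pi>\<in>H. v (r \<pi> a)) / card H"
  shows "(\<Sum>a\<in>X. \<Sum>b\<in>X. w a * w b * K a b) \<le> (\<Sum>a\<in>X. \<Sum>b\<in>X. v a * v b * K a b)"
proof -
  define B where "B = (\<lambda>x y. \<Sum>a\<in>X. \<Sum>b\<in>X. x a * y b * K a b)"
  have card: "0 < real (card H)"
    using assms by (simp add: card_gt_0_iff)
  have Bsym: "B x y = B y x" for x y
    unfolding B_def by (subst sum.swap) (auto intro!: sum.cong simp: sym mult_ac)
  have Binv: "B (\<lambda>a. v (r \<pi> a)) (\<lambda>a. v (r \<pi> a)) = B v v" if "\<pi> \<in> H" for \<pi>
  proof -
    have "B v v = (\<Sum>a\<in>X. \<Sum>b\<in>X. v (r \<pi> a) * v b * K (r \<pi> a) b)"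
      unfolding B_def by (rule sum.reindex_bij_betw[OF bij[OF that], symmetric])
    also have "\<dots> = (\<Sum>a\<in>X. \<Sum>b\<in>X. v (r \<pi> a) * v (r \<pi> b) * K (r \<pi> a) (r \<pi> b))"
      by (intro sum.cong refl sum.reindex_bij_betw[OF bij[OF that], symmetric])
    finally show ?thesis
      by (simp add: B_def inv that)
  qed
  have Bw: "(\<Sum>\<pi>\<in>H. B (\<lambda>a. v (r \<pi> a)) w) = card H * B w w"
  proof -
    have "(\<Sum>\<pi>\<in>H. B (\<lambda>a. v (r \<pi> a)) w) = (\<Sum>a\<in>X. \<Sum>b\<in>X. (\<Sum>\<pi>\<in>H. v (r \<pi> a)) * w b * K a b)"
      unfolding B_def by (subst sum.swap, rule sum.cong[OF refl], subst sum.swap)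
        (simp add: sum_distrib_right)
    also have "\<dots> = (\<Sum>a\<in>X. \<Sum>b\<in>X. (card H * w a) * w b * K a b)"
      using card by (simp add: w_def)
    finally show ?thesis
      by (simp add: B_def sum_distrib_left mult_ac)
  qed
  have expand: "B (\<lambda>a. x a - w a) (\<lambda>a. x a - w a) = B x x - 2 * B x w + B w w" for x
  proof -
    have "B (\<lambda>a. x a - w a) (\<lambda>a. x a - w a) = B x x - B x w - B w x + B w w"
      by (simp add: B_def algebra_simps sum.distrib sum_subtractf)
    then show ?thesis
      by (simp add: Bsym[of w x])
  qed
  have "0 \<le> (\<Sum>\<pi>\<in>H. B (\<lambda>a. v (r \<pi> a) - w a) (\<lambda>a. v (r \<pi> a) - w a))"
    unfolding B_def by (intro sum_nonneg psd_onD[OF psd])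
  also have "\<dots> = card H * (B v v - B w w)"
    using Bw by (simp add: expand Binv sum.distrib sum_subtractf algebra_simps flip: sum_distrib_left)
  finally have "0 \<le> B v v - B w w"
    using card by (simp add: zero_le_mult_iff)
  then show ?thesis
    by (simp add: B_def)
qed

text \<open>Averaging must keep the largest coordinate, hence a separate \<open>H x\<close> fixing
  each index \<open>x\<close>. Dividing by \<open>card (H x)\<close> does not affect signs, so
  \<open>avg\<close> is stated with plain sums.\<close>

lemma psd_on_of_stabilizer_averages:
  fixes K :: "'a \<Rightarrow> 'a \<Rightarrow> real" and r :: "'g \<Rightarrow> 'a \<Rightarrow> 'a"
  assumes fin: "finite X"
    and sym: "\<And>a b. a \<in> X \<Longrightarrow> b \<in> X \<Longrightarrow> K a b = K b a"
    and H: "\<And>x. x \<in> X \<Longrightarrow> finite (H x) \<and> H x \<noteq> {}"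
    and bij: "\<And>x \<pi>. x \<in> X \<Longrightarrow> \<pi> \<in> H x \<Longrightarrow> bij_betw (r \<pi>) X X"
    and inv: "\<And>x \<pi> a b. x \<in> X \<Longrightarrow> \<pi> \<in> H x \<Longrightarrow> a \<in> X \<Longrightarrow> b \<in> X \<Longrightarrow> K (r \<pi> a) (r \<pi> b) = K a b"
    and fixed: "\<And>x \<pi>. x \<in> X \<Longrightarrow> \<pi> \<in> H x \<Longrightarrow> r \<pi> x = x"
    and avg: "\<And>x v. x \<in> X \<Longrightarrow>
      0 \<le> (\<Sum>a\<in>X. \<Sum>b\<in>X. (\<Sum>\<pi>\<in>H x. v (r \<pi> a)) * (\<Sum>\<pi>\<in>H x. v (r \<pi> b)) * K a b)"
  shows "psd_on X K"
  unfolding psd_on_def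
proof
  fix v0 :: "'a \<Rightarrow> real"
  define q where "q = (\<lambda>v::'a \<Rightarrow> real. \<Sum>a\<in>X. \<Sum>b\<in>X. v a * v b * K a b)"
  define sq where "sq = (\<lambda>v::'a \<Rightarrow> real. \<Sum>a\<in>X. (v a)\<^sup>2)"
  define N where "N = real (card X)"
  have step: "- (c * (1 - 1 / N)) * sq v \<le> q v"
    if "0 \<le> c" and lower: "\<And>v. - c * sq v \<le> q v" for c v
  proof (cases "X = {}")
    case False
    then have N: "0 < N"
      using fin by (simp add: N_def card_gt_0_iff)
    \<comment> \<open>An index of maximal square carries at least the mean,
      \<open>sq v / N\<close>.\<close>
    have "Max ((\<lambda>y. (v y)\<^sup>2) ` X) \<in> (\<lambda>y. (v y)\<^sup>2) ` X"
      using fin False by (intro Max_in) auto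
    then obtain x where x: "x \<in> X" and "Max ((\<lambda>y. (v y)\<^sup>2) ` X) = (v x)\<^sup>2"
      by auto
    then have max: "(v y)\<^sup>2 \<le> (v x)\<^sup>2" if "y \<in> X" for y
      using Max_ge[of "(\<lambda>y. (v y)\<^sup>2) ` X" "(v y)\<^sup>2"] fin that by auto
    have "sq v \<le> N * (v x)\<^sup>2"
      using sum_bounded_above[of X "\<lambda>a. (v a)\<^sup>2", OF max] by (simp add: sq_def N_def)
    then have big: "sq v / N \<le> (v x)\<^sup>2"
      using N by (simp add: field_simps)
    define w where "w = (\<lambda>a. (\<Sum>\<pi>\<in>H x. v (r \<pi> a)) / card (H x))"
    have wx: "w x = v x"
      using H[OF x] by (simp add: w_def fixed[OF x])
    \<comment> \<open>Adding \<open>c\<close> times the identity makes the form nonnegative; it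
      stays invariant since each \<open>r \<pi>\<close> is injective on \<open>X\<close>.\<close>
    define L where "L = (\<lambda>a b. K a b + (if a = b then c else 0))"
    have L: "(\<Sum>a\<in>X. \<Sum>b\<in>X. u a * u b * L a b) = q u + c * sq u" for u
    proof -
      have "(\<Sum>a\<in>X. \<Sum>b\<in>X. u a * u b * L a b) =
          q u + (\<Sum>a\<in>X. \<Sum>b\<in>X. if a = b then u a * u b * c else 0)"
        unfolding q_def sum.distrib[symmetric]
        by (intro sum.cong refl) (simp add: L_def distrib_left)
      also have "(\<Sum>a\<in>X. \<Sum>b\<in>X. if a = b then u a * u b * c else 0) = c * sq u"
        using fin by (simp add: sq_def sum_distrib_left power2_eq_square mult_ac)
      finally show ?thesis .
    qed
    have "q w + c * sq w \<le> q v + c * sq v"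
      unfolding L[symmetric] w_def
    proof (rule quadratic_form_average)
      show "psd_on X L"
        unfolding psd_on_def L using lower by (smt (verit) mult_minus_left)
      show "L (r \<pi> a) (r \<pi> b) = L a b" if "\<pi> \<in> H x" "a \<in> X" "b \<in> X" for \<pi> a b
        using inj_on_eq_iff[OF bij_betw_imp_inj_on[OF bij[OF x that(1)]] that(2,3)]
        by (simp add: L_def inv[OF x that])
    qed (use H[OF x] bij[OF x] in \<open>auto simp: L_def sym\<close>)
    moreover have "0 \<le> q w"
    proof -
      have "q w = (\<Sum>a\<in>X. \<Sum>b\<in>X. (\<Sum>\<pi>\<in>H x. v (r \<pi> a)) * (\<Sum>\<pi>\<in>H x. v (r \<pi> b)) * K a b) / (card (H x))\<^sup>2"
        unfolding q_def w_def sum_divide_distrib[of _ X]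
        by (intro sum.cong refl) (simp add: power2_eq_square)
      then show ?thesis
        using avg[OF x, of v] by simp
    qed
    moreover have "(v x)\<^sup>2 \<le> sq w"
      unfolding wx[symmetric] sq_def by (rule member_le_sum[OF x]) (auto simp: fin)
    then have "c * (sq v / N) \<le> c * sq w"
      using big \<open>0 \<le> c\<close> by (intro mult_left_mono) auto
    ultimately show ?thesis
      by (simp add: algebra_simps)
  qed (simp add: sq_def q_def)
  \<comment> \<open>A crude first constant suffices: each \<open>\<bar>v a * v b\<bar>\<close> is at
    most \<open>sq v\<close>.\<close>
  define c0 where "c0 = (\<Sum>a\<in>X. \<Sum>b\<in>X. \<bar>K a b\<bar>)"
  have base: "- c0 * sq v \<le> q v" for v
  proof -
    have bound: "- (\<bar>K a b\<bar> * sq v) \<le> v a * v b * K a b" if "a \<in> X" "b \<in> X" for a b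
    proof -
      have "(v a)\<^sup>2 \<le> sq v" "(v b)\<^sup>2 \<le> sq v"
        unfolding sq_def using that fin by (auto intro!: member_le_sum)
      moreover have "2 * \<bar>v a * v b\<bar> \<le> (v a)\<^sup>2 + (v b)\<^sup>2"
        using sum_squares_bound[of "\<bar>v a\<bar>" "\<bar>v b\<bar>"] by (simp add: abs_mult mult_ac)
      ultimately have "\<bar>v a * v b\<bar> * \<bar>K a b\<bar> \<le> sq v * \<bar>K a b\<bar>"
        by (intro mult_right_mono) auto
      then have "\<bar>v a * v b * K a b\<bar> \<le> \<bar>K a b\<bar> * sq v"
        by (simp add: abs_mult mult_ac)
      then show ?thesis
        by linarith
    qed
    have "- c0 * sq v = (\<Sum>a\<in>X. \<Sum>b\<in>X. - (\<bar>K a b\<bar> * sq v))"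
      by (simp add: c0_def sum_distrib_right sum_negf)
    also have "\<dots> \<le> q v"
      unfolding q_def by (intro sum_mono bound)
    finally show ?thesis .
  qed
  have c0: "0 \<le> c0"
    by (simp add: c0_def sum_nonneg)
  \<comment> \<open>For empty \<open>X\<close> division by zero makes the ratio 1, so the strict
    bound is conditional.\<close>
  have ratio: "0 \<le> 1 - 1 / N" "X \<noteq> {} \<Longrightarrow> 1 - 1 / N < 1"
    using fin by (auto simp: N_def card_gt_0_iff divide_le_eq_1 Suc_le_eq)
  have iter: "- (c0 * (1 - 1 / N) ^ m) * sq v \<le> q v" for m v
  proof (induction m arbitrary: v)
    case (Suc m)
    show ?case
      using step[OF _ Suc] c0 ratio by (simp add: mult_ac)
  qed (use base in simp)
  show "0 \<le> (\<Sum>a\<in>X. \<Sum>b\<in>X. v0 a * v0 b * K a b)"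
  proof (cases "X = {}")
    case False
    have "(\<lambda>m. - (c0 * (1 - 1 / N) ^ m) * sq v0) \<longlonglongrightarrow> - (c0 * 0) * sq v0"
      using ratio False by (intro tendsto_intros LIMSEQ_power_zero) auto
    then show ?thesis
      using LIMSEQ_le_const2[of _ 0 "q v0"] iter by (auto simp: q_def)
  qed simp
qed

subsection \<open>Pseudo-moments of matchings\<close>

text \<open>Edges are two-element sets rather than ordered pairs, so vertex permutations act on them
  directly.\<close>

definition matching :: "'a set \<Rightarrow> 'a set set \<Rightarrow> bool" where
  "matching J M \<longleftrightarrow> (\<forall>e\<in>M. e \<subseteq> J \<and> card e = 2) \<and> pairwise disjnt M"

lemma matching_empty [simp]: "matching J {}"
  by (simp add: matching_def)

lemma matching_empty_vertices [simp]: "matching {} M \<longleftrightarrow> M = {}"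
  by (fastforce simp: matching_def)

lemma matching_mono: "matching J M \<Longrightarrow> J \<subseteq> J' \<Longrightarrow> M' \<subseteq> M \<Longrightarrow> matching J' M'"
  unfolding matching_def by (meson pairwise_subset subset_trans subsetD)

lemma matching_Diff: "matching (J - S) M \<longleftrightarrow> matching J M \<and> S \<inter> \<Union>M = {}"
  unfolding matching_def by blast

lemma matching_Int: "matching (J \<inter> S) M \<longleftrightarrow> matching J M \<and> \<Union>M \<subseteq> S"
  unfolding matching_def by blast

lemma matching_finite: "finite J \<Longrightarrow> matching J M \<Longrightarrow> finite M"
  unfolding matching_def by (meson PowI finite_Pow_iff finite_subset subsetI)

lemma finite_matchings: "finite J \<Longrightarrow> finite {M. matching J M}"
  by (rule finite_subset[of _ "Pow (Pow J)"]) (auto simp: matching_def)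

lemma matching_Union: "matching J M \<Longrightarrow> \<Union>M \<subseteq> J"
  unfolding matching_def by blast

lemma card_Union_matching:
  assumes "finite J" "matching J M"
  shows "card (\<Union>M) = 2 * card M"
proof -
  have "card (\<Union>M) = (\<Sum>e\<in>M. card e)"
    using assms by (intro card_Union_disjoint) (auto simp: matching_def intro: finite_subset)
  also have "\<dots> = 2 * card M"
    using assms by (simp add: matching_def)
  finally show ?thesis .
qed

lemma matching_insert:
  assumes "matching J M" "i \<in> J" "j \<in> J" "i \<noteq> j" "i \<notin> \<Union>M" "j \<notin> \<Union>M"
  shows "matching J (insert {i, j} M)"
  using assms by (auto simp: matching_def pairwise_insert disjnt_iff)

lemma matching_eqI: "matching J M \<Longrightarrow> e \<in> M \<Longrightarrow> e' \<in> M \<Longrightarrow> i \<in> e \<Longrightarrow> i \<in> e' \<Longrightarrow> e = e'"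
  unfolding matching_def pairwise_def disjnt_iff by blast

lemma matching_obtain_partner:
  assumes "matching J M" "e \<in> M" "i \<in> e"
  obtains j where "e = {i, j}" "j \<noteq> i" "j \<in> J"
proof -
  have "card e = 2" "e \<subseteq> J"
    using assms by (auto simp: matching_def)
  then show thesis
    using that \<open>i \<in> e\<close> by (auto simp: card_2_iff)
qed

section \<open>Weights of matchings, vertex equations and conditioning\<close>

definition pm_weight :: "nat \<Rightarrow> nat \<Rightarrow> real" where
  "pm_weight n m = (\<Prod>i<m. 1 / (real n - 1 - 2 * real i))"

text \<open>\<open>J\<close> holds the visible vertices, while \<open>n\<close> counts those of the
  whole graph and sets the weights. They are separate because conditioning removes two vertices from
  the graph but possibly only one from \<open>J\<close>.\<close>

definition pexp :: "'a set \<Rightarrow> nat \<Rightarrow> 'a set set \<Rightarrow> real" where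
  "pexp J n M = (if matching J M then pm_weight n (card M) else 0)"

lemma pm_weight_Suc: "pm_weight n (Suc m) = pm_weight n m / (real n - 1 - 2 * real m)"
  by (simp add: pm_weight_def)

lemma pm_weight_Suc_shift:
  assumes "2 \<le> n"
  shows "pm_weight n (Suc m) = pm_weight (n - 2) m / (real n - 1)"
proof -
  have "(\<Prod>i<m. 1 / (real n - 1 - 2 * real (Suc i))) = (\<Prod>i<m. 1 / (real (n - 2) - 1 - 2 * real i))"
    using assms by (intro prod.cong refl) (simp add: of_nat_diff algebra_simps)
  then show ?thesis
    unfolding pm_weight_def prod.lessThan_Suc_shift by simp
qed

text \<open>Compares two ways of splitting a factor off \<open>pm_weight n (Suc m)\<close>, the last
  or the first. The bound on \<open>m\<close> keeps the cancelled denominator positive.\<close>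

lemma pm_weight_shift:
  assumes "2 \<le> n" "2 * m + 1 < n"
  shows "pm_weight n m = (real n - 1 - 2 * real m) / (real n - 1) * pm_weight (n - 2) m"
proof -
  have "0 < real n - 1 - 2 * real m"
    using assms by linarith
  then show ?thesis
    using pm_weight_Suc[of n m] pm_weight_Suc_shift[OF assms(1), of m] by (simp add: field_simps)
qed

lemma pexp_eq_0_superset: "\<not> matching J M \<Longrightarrow> M \<subseteq> M' \<Longrightarrow> pexp J n M' = 0"
  by (metis matching_mono order_refl pexp_def)

text \<open>The vertex equation of \<open>i\<close> times the monomial \<open>E\<close>. A covered
  \<open>i\<close> admits only its own partner; an uncovered one has
  \<open>card V - 1 - 2 * card E\<close> free partners, exactly the denominator that the extra edge
  brings. The size bound keeps it positive.\<close>

lemma sum_pexp_insert: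
  assumes V: "finite V" "i \<in> V" and size: "matching V E \<Longrightarrow> 2 * card E + 3 \<le> card V"
  shows "(\<Sum>j\<in>V - {i}. pexp V (card V) (insert {i, j} E)) = pexp V (card V) E"
proof (cases "matching V E")
  case True
  note M = True
  show ?thesis
  proof (cases "i \<in> \<Union>E")
    case True
    then obtain e where "e \<in> E" "i \<in> e"
      by blast
    with M obtain p where p: "{i, p} \<in> E" "p \<noteq> i" "p \<in> V"
      using matching_obtain_partner by metis
    \<comment> \<open>Inserting \<open>{i, p}\<close> leaves \<open>E\<close> unchanged; any other
      \<open>j\<close> puts \<open>i\<close> on two edges.\<close>
    have "pexp V (card V) (insert {i, j} E) = (if j = p then pexp V (card V) E else 0)" for j
    proof (cases "j = p")
      case False
      have "\<not> matching V (insert {i, j} E)"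
      proof
        assume "matching V (insert {i, j} E)"
        then have "{i, j} = {i, p}"
          using p by (elim matching_eqI[where i = i]) auto
        with False show False
          by (auto simp: doubleton_eq_iff)
      qed
      with False show ?thesis
        by (simp add: pexp_def)
    qed (use p in \<open>simp add: insert_absorb\<close>)
    then show ?thesis
      using V p by simp
  next
    case False
    have fin: "finite E" "finite (\<Union>E)"
      using matching_finite[OF V(1) M] finite_subset[OF matching_Union[OF M] V(1)] by auto
    have "(\<Sum>j\<in>V - {i}. pexp V (card V) (insert {i, j} E)) =
      (\<Sum>j\<in>V - {i} - \<Union>E. pm_weight (card V) (Suc (card E)))"
    proof (rule sum.mono_neutral_cong_right)
      show "pexp V (card V) (insert {i, j} E) = pm_weight (card V) (Suc (card E))"
        if "j \<in> V - {i} - \<Union>E" for j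
      proof -
        have "{i, j} \<notin> E"
          using False by blast
        then show ?thesis
          using matching_insert[OF M, of i j] V False that fin by (auto simp: pexp_def)
      qed
      show "\<forall>j\<in>V - {i} - (V - {i} - \<Union>E). pexp V (card V) (insert {i, j} E) = 0"
      proof
        fix j
        assume j: "j \<in> V - {i} - (V - {i} - \<Union>E)"
        then obtain e where e: "e \<in> E" "j \<in> e"
          by blast
        have "\<not> matching V (insert {i, j} E)"
        proof
          assume "matching V (insert {i, j} E)"
          then have "{i, j} = e"
            using e by (elim matching_eqI[where i = j]) auto
          with False e show False
            by blast
        qed
        then show "pexp V (card V) (insert {i, j} E) = 0"
          by (simp add: pexp_def)
      qed
    qed (use V in auto)
    also have "\<dots> = real (card (V - {i} - \<Union>E)) * pm_weight (card V) (Suc (card E))"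
      by simp
    also have "card (V - {i} - \<Union>E) = card V - 1 - 2 * card E"
      using matching_Union[OF M] False V fin card_Union_matching[OF V(1) M]
      by (subst card_Diff_subset) auto
    also have "real (card V - 1 - 2 * card E) = real (card V) - 1 - 2 * real (card E)"
      using size[OF M] by (simp add: of_nat_diff)
    also have "\<dots> * pm_weight (card V) (Suc (card E)) = pm_weight (card V) (card E)"
      using size[OF M] by (simp add: pm_weight_Suc)
    finally show ?thesis
      using M by (simp add: pexp_def)
  qed
next
  case False
  then show ?thesis
    by (simp add: pexp_eq_0_superset[OF False] subset_insertI)
qed

text \<open>Conditioning on the partner of \<open>i\<close>: either some \<open>j \<in> J\<close>, or one of the vertices outside \<open>J\<close>,
  which \<open>M\<close> does not see and which together have weight \<open>(n - card J) / (n - 1)\<close>.\<close>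

lemma pexp_condition:
  assumes J: "finite J" "i \<in> J" and n: "2 * card J \<le> n"
  shows "pexp J n M = 1 / (real n - 1) * ((\<Sum>j\<in>J - {i}. pexp (J - {i, j}) (n - 2) (M - {{i, j}})) +
    (real n - card J) * pexp (J - {i}) (n - 2) M)"
proof -
  have n2: "2 \<le> n"
    using J n card_gt_0_iff[of J] by fastforce
  \<comment> \<open>Serves the case that \<open>M\<close> is no matching: then no term conditioned
    on a partner \<open>j\<close> can be nonzero.\<close>
  have extend: "matching J M" if "matching (J - {i, j}) (M - {{i, j}})" "j \<in> J - {i}" for j
  proof -
    have "matching J (insert {i, j} (M - {{i, j}}))"
      using that J unfolding matching_Diff by (intro matching_insert) auto
    then show ?thesis
      by (rule matching_mono) auto
  qed
  show ?thesis
  proof (cases "matching J M")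
    case True
    note M = True
    show ?thesis
    proof (cases "i \<in> \<Union>M")
      case True
      then obtain e where "e \<in> M" "i \<in> e"
        by blast
      with M obtain p where p: "{i, p} \<in> M" "p \<noteq> i" "p \<in> J"
        using matching_obtain_partner by metis
      have finM: "finite M"
        using matching_finite[OF J(1) M] .
      have "matching (J - {i, p}) (M - {{i, p}})"
        unfolding matching_Diff
      proof
        show "matching J (M - {{i, p}})"
          by (rule matching_mono[OF M]) auto
        show "{i, p} \<inter> \<Union> (M - {{i, p}}) = {}"
          using matching_eqI[OF M _ p(1)] by blast
      qed
      \<comment> \<open>For \<open>j \<noteq> p\<close> the edge \<open>{i, p}\<close> survives the
        deletion and still meets \<open>i\<close>, so the term vanishes.\<close>
      then have "pexp (J - {i, j}) (n - 2) (M - {{i, j}}) =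
          (if j = p then pm_weight (n - 2) (card M - 1) else 0)" for j
        using p finM by (auto simp: pexp_def matching_Diff doubleton_eq_iff)
      moreover have "pexp (J - {i}) (n - 2) M = 0"
        using True by (auto simp: pexp_def matching_Diff)
      ultimately have "1 / (real n - 1) * ((\<Sum>j\<in>J - {i}. pexp (J - {i, j}) (n - 2) (M - {{i, j}})) +
        (real n - card J) * pexp (J - {i}) (n - 2) M) = pm_weight n (Suc (card M - 1))"
        using p J by (simp add: pm_weight_Suc_shift[OF n2])
      also have "Suc (card M - 1) = card M"
        using card_gt_0_iff[of M] finM p by auto
      finally show ?thesis
        using M by (simp add: pexp_def)
    next
      case False
      have fin: "finite (\<Union>M)"
        using finite_subset[OF matching_Union[OF M] J(1)] .
      have sub: "\<Union>M \<subseteq> J - {i}"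
        using False matching_Union[OF M] by auto
      have "pexp (J - {i, j}) (n - 2) (M - {{i, j}}) =
          (if j \<notin> \<Union>M then pm_weight (n - 2) (card M) else 0)" for j
      proof -
        have "M - {{i, j}} = M"
          using False by blast
        then show ?thesis
          using False M by (simp add: pexp_def matching_Diff)
      qed
      then have "(\<Sum>j\<in>J - {i}. pexp (J - {i, j}) (n - 2) (M - {{i, j}})) =
          (\<Sum>j\<in>J - {i} - \<Union>M. pm_weight (n - 2) (card M))"
        using J by (intro sum.mono_neutral_cong_right) auto
      also have "\<dots> = real (card (J - {i} - \<Union>M)) * pm_weight (n - 2) (card M)"
        by simp
      also have "card (J - {i} - \<Union>M) = card J - 1 - 2 * card M"
        using sub J fin card_Union_matching[OF J(1) M] by (subst card_Diff_subset) auto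
      finally have sum: "(\<Sum>j\<in>J - {i}. pexp (J - {i, j}) (n - 2) (M - {{i, j}})) =
        real (card J - 1 - 2 * card M) * pm_weight (n - 2) (card M)" .
      have le: "2 * card M \<le> card J - 1"
        using card_mono[OF _ sub] J card_Union_matching[OF J(1) M] by simp
      have pos: "0 < card J"
        using J card_gt_0_iff by blast
      have "pexp (J - {i}) (n - 2) M = pm_weight (n - 2) (card M)"
        using False M by (simp add: pexp_def matching_Diff)
      \<comment> \<open>The free partners inside \<open>J\<close> and the \<open>n - card J\<close>
        outside add up to the numerator in \<open>pm_weight_shift\<close>.\<close>
      then have "(\<Sum>j\<in>J - {i}. pexp (J - {i, j}) (n - 2) (M - {{i, j}})) +
          (real n - card J) * pexp (J - {i}) (n - 2) M =
          (real n - 1 - 2 * real (card M)) * pm_weight (n - 2) (card M)"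
        using le pos by (simp add: sum of_nat_diff algebra_simps)
      then show ?thesis
        using M pm_weight_shift[OF n2, of "card M"] le pos n by (simp add: pexp_def)
    qed
  next
    case False
    then have "pexp (J - {i, j}) (n - 2) (M - {{i, j}}) = 0" if "j \<in> J - {i}" for j
      using extend that by (auto simp: pexp_def)
    then show ?thesis
      using False by (simp add: pexp_def matching_Diff)
  qed
qed

text \<open>Induction on \<open>card J\<close>: conditioning on the partner of some \<open>i\<close>
  writes the kernel as a nonnegative combination of pulled-back kernels over smaller vertex sets.
  The bound \<open>2 * card J \<le> n\<close> makes the outside weight nonnegative and persists, as
  \<open>J\<close> loses at least one vertex while \<open>n\<close> drops by two.\<close>

lemma psd_on_pexp:
  assumes "finite J" "2 * card J \<le> n" "finite X"
  shows "psd_on X (\<lambda>A B. pexp J n (A \<union> B))"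
  using assms
proof (induction "card J" arbitrary: J n X rule: less_induct)
  case less
  show ?case
  proof (cases "J = {}")
    case True
    \<comment> \<open>With no vertices left the moment is 1 exactly when both sets are empty: a
      rank-one kernel, whose form is a square.\<close>
    have "(\<Sum>A\<in>X. \<Sum>B\<in>X. v A * v B * pexp J n (A \<union> B)) =
        (\<Sum>A\<in>X. v A * of_bool (A = {})) * (\<Sum>B\<in>X. v B * of_bool (B = {}))" for v
      unfolding sum_product using True
      by (intro sum.cong refl) (auto simp: pexp_def pm_weight_def)
    then show ?thesis
      by (simp add: psd_on_def)
  next
    case False
    then obtain i where i: "i \<in> J"
      by blast
    have *: "2 * card J' \<le> n - 2 \<and> card J' < card J \<and> finite J'" if "J' \<subseteq> J - {i}" for J'
      using card_mono[OF _ that] less.prems i card_gt_0_iff[of J] finite_subset[OF that] by auto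
    have "psd_on X (\<lambda>A B. 1 / (real n - 1) *
      ((\<Sum>j\<in>J - {i}. pexp (J - {i, j}) (n - 2) ((A - {{i, j}}) \<union> (B - {{i, j}}))) +
        (real n - card J) * pexp (J - {i}) (n - 2) (A \<union> B)))"
    proof (intro psd_on_scale psd_on_add psd_on_sum)
      fix j
      assume "j \<in> J - {i}"
      \<comment> \<open>Deleting the edge can identify members of \<open>X\<close>, so the induction
        hypothesis is used on the image.\<close>
      have "psd_on ((\<lambda>A. A - {{i, j}}) ` X) (\<lambda>A B. pexp (J - {i, j}) (n - 2) (A \<union> B))"
        using *[of "J - {i, j}"] less.prems by (intro less.hyps) auto
      then show "psd_on X (\<lambda>A B. pexp (J - {i, j}) (n - 2) ((A - {{i, j}}) \<union> (B - {{i, j}})))"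
        by (rule psd_on_vimage[OF less.prems(3) finite_imageI[OF less.prems(3)] subset_refl])
    next
      show "psd_on X (\<lambda>A B. pexp (J - {i}) (n - 2) (A \<union> B))"
        using *[of "J - {i}"] less.prems by (intro less.hyps) auto
    qed (use less.prems i card_gt_0_iff[of J] in \<open>auto simp: Suc_le_eq\<close>)
    then show ?thesis
      unfolding pexp_condition[OF less.prems(1) i less.prems(2)] Un_Diff .
  qed
qed

subsection \<open>Positivity of the pseudo-moments\<close>

definition act :: "('a \<Rightarrow> 'a) \<Rightarrow> 'a set set \<Rightarrow> 'a set set" where
  "act \<pi> M = image \<pi> ` M"

lemma act_insert: "act \<pi> (insert {a, b} M) = insert {\<pi> a, \<pi> b} (act \<pi> M)"
  by (simp add: act_def)

lemma act_Un: "act \<pi> (A \<union> B) = act \<pi> A \<union> act \<pi> B"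
  by (auto simp: act_def)

lemma act_comp: "act (\<pi> \<circ> \<tau>) M = act \<pi> (act \<tau> M)"
  by (simp add: act_def image_image image_comp)

lemma act_id_on:
  assumes "\<And>x. x \<in> \<Union>M \<Longrightarrow> \<pi> x = x"
  shows "act \<pi> M = M"
proof -
  have "\<pi> ` e = e" if "e \<in> M" for e
  proof -
    have "\<pi> ` e = (\<lambda>x. x) ` e"
      using assms that by (intro image_cong) auto
    then show ?thesis
      by simp
  qed
  then show ?thesis
    by (simp add: act_def cong: image_cong)
qed

lemma act_inv_act: "\<pi> permutes V \<Longrightarrow> act (inv \<pi>) (act \<pi> M) = M"
  by (simp add: act_comp[symmetric] permutes_inv_o act_id_on)

lemma act_act_inv: "\<pi> permutes V \<Longrightarrow> act \<pi> (act (inv \<pi>) M) = M"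
  by (simp add: act_comp[symmetric] permutes_inv_o act_id_on)

lemma card_act: "\<pi> permutes V \<Longrightarrow> card (act \<pi> M) = card M"
  unfolding act_def by (meson card_image inj_image_eq_iff inj_onI permutes_inj)

lemma matching_actI:
  assumes "\<pi> permutes V" "matching V M"
  shows "matching V (act \<pi> M)"
proof -
  have inj: "inj \<pi>"
    using assms by (simp add: permutes_inj)
  have "pairwise disjnt (act \<pi> M)"
    using assms(2) unfolding act_def matching_def pairwise_image
    by (auto simp: pairwise_def disjnt_def inj image_Int[symmetric])
  moreover have "\<pi> ` e \<subseteq> V \<and> card (\<pi> ` e) = 2" if "e \<in> M" for e
    using assms that permutes_in_image[OF assms(1)]
    by (auto simp: matching_def card_image inj_on_subset[OF inj])
  ultimately show ?thesis
    by (auto simp: matching_def act_def)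
qed

lemma matching_act: "\<pi> permutes V \<Longrightarrow> matching V (act \<pi> M) \<longleftrightarrow> matching V M"
  by (metis act_inv_act matching_actI permutes_inv)

lemma pexp_act: "\<pi> permutes V \<Longrightarrow> pexp V n (act \<pi> M) = pexp V n M"
  by (simp add: pexp_def matching_act card_act)

section \<open>Matchings with few edges, and the reduction of orbit sums\<close>

definition small_matchings :: "'a set \<Rightarrow> nat \<Rightarrow> 'a set set set" where
  "small_matchings V k = {M. matching V M \<and> card M \<le> k}"

lemma finite_small_matchings: "finite V \<Longrightarrow> finite (small_matchings V k)"
  unfolding small_matchings_def by (rule finite_subset[OF _ finite_matchings]) auto

lemma small_matchings_mono: "J \<subseteq> V \<Longrightarrow> small_matchings J k \<subseteq> small_matchings V k"
  by (auto simp: small_matchings_def intro: matching_mono)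

lemma bij_betw_act_small_matchings:
  assumes "\<pi> permutes V"
  shows "bij_betw (act \<pi>) (small_matchings V k) (small_matchings V k)"
  by (rule bij_betw_byWitness[where f' = "act (inv \<pi>)"])
    (use assms permutes_inv[OF assms] in
      \<open>auto simp: small_matchings_def act_inv_act act_act_inv matching_act card_act\<close>)

text \<open>Modulo the vertex equations, the functional \<open>F\<close> is multiplication by a polynomial in the edges
  inside \<open>J\<close>, followed by \<^const>\<open>pexp\<close>.\<close>

definition reducible :: "'a set \<Rightarrow> nat \<Rightarrow> 'a set \<Rightarrow> ('a set set \<Rightarrow> real) \<Rightarrow> bool" where
  "reducible V k J F \<longleftrightarrow> (\<exists>c. \<forall>E\<in>small_matchings V k.
     F E = (\<Sum>C\<in>small_matchings J k. c C * pexp V (card V) (C \<union> E)))"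

lemma reducible_cong:
  "reducible V k J F \<Longrightarrow> (\<And>E. E \<in> small_matchings V k \<Longrightarrow> F E = G E) \<Longrightarrow> reducible V k J G"
  by (simp add: reducible_def)

lemma reducible_scale:
  assumes "reducible V k J F"
  shows "reducible V k J (\<lambda>E. r * F E)"
proof -
  from assms obtain c where "\<forall>E\<in>small_matchings V k.
     F E = (\<Sum>C\<in>small_matchings J k. c C * pexp V (card V) (C \<union> E))"
    unfolding reducible_def by blast
  then show ?thesis
    unfolding reducible_def by (intro exI[of _ "\<lambda>C. r * c C"]) (simp add: sum_distrib_left mult_ac)
qed

lemma reducible_add:
  assumes "reducible V k J F" "reducible V k J G"
  shows "reducible V k J (\<lambda>E. F E + G E)"
proof -
  from assms obtain c d where "\<forall>E\<in>small_matchings V k.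
     F E = (\<Sum>C\<in>small_matchings J k. c C * pexp V (card V) (C \<union> E))"
    "\<forall>E\<in>small_matchings V k.
     G E = (\<Sum>C\<in>small_matchings J k. d C * pexp V (card V) (C \<union> E))"
    unfolding reducible_def by blast
  then show ?thesis
    unfolding reducible_def
    by (intro exI[of _ "\<lambda>C. c C + d C"]) (simp add: sum.distrib distrib_right)
qed

lemma reducible_diff:
  assumes "reducible V k J F" "reducible V k J G"
  shows "reducible V k J (\<lambda>E. F E - G E)"
  using reducible_add[OF assms(1) reducible_scale[OF assms(2), of "-1"]] by simp

lemma reducible_sum:
  "(\<And>i. i \<in> I \<Longrightarrow> reducible V k J (F i)) \<Longrightarrow> reducible V k J (\<lambda>E. \<Sum>i\<in>I. F i E)"
proof (induction I rule: infinite_finite_induct)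
  case (insert i I)
  then show ?case
    by (simp add: reducible_add)
qed (auto simp: reducible_def intro!: exI[of _ "\<lambda>_. 0"])

text \<open>If \<open>{a, b} \<in> B\<close> with \<open>b \<notin> J\<close>, the orbit sum does not change when \<open>b\<close> is replaced by another
  vertex that is neither in \<open>J\<close> nor covered by \<open>B\<close>. The vertex equation of \<open>a\<close> then expresses it by
  the orbit sums of matchings that cover fewer vertices outside \<open>J\<close>.\<close>

lemma reducible_sum_act:
  assumes V: "finite V" "J \<subseteq> V" "4 * k < card V" and "B \<in> small_matchings V k"
  shows "reducible V k J (\<lambda>E. \<Sum>\<pi>\<in>{\<pi>. \<pi> permutes (V - J)}. pexp V (card V) (act \<pi> B \<union> E))"
  using assms(4)
proof (induction "card (\<Union>B - J)" arbitrary: B rule: less_induct)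
  case less
  let ?H = "{\<pi>. \<pi> permutes (V - J)}"
  define F where "F = (\<lambda>B E. \<Sum>\<pi>\<in>?H. pexp V (card V) (act \<pi> B \<union> E))"
  have B: "matching V B" "card B \<le> k" "finite B"
    using less.prems matching_finite[OF V(1)] by (auto simp: small_matchings_def)
  have finU: "finite (\<Union>B)"
    using finite_subset[OF matching_Union[OF B(1)] V(1)] .
  show ?case
  proof (cases "\<Union>B \<subseteq> J")
    case True
    \<comment> \<open>These permutations fix every vertex of \<open>J\<close>, so the sum is a
      multiple of one moment, and a single coefficient at \<open>B\<close> is the witness.\<close>
    have "act \<pi> B = B" if "\<pi> permutes (V - J)" for \<pi>
      using True that by (intro act_id_on) (auto simp: permutes_def)
    then have "(\<Sum>\<pi>\<in>?H. pexp V (card V) (act \<pi> B \<union> E)) = card ?H * pexp V (card V) (B \<union> E)" for E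
      by simp
    moreover have "matching J B"
      using matching_Int[of V J B] B True V(2) by (simp add: Int_absorb1)
    then have "B \<in> small_matchings J k"
      using B by (simp add: small_matchings_def)
    ultimately show ?thesis
      unfolding reducible_def using finite_small_matchings[OF finite_subset[OF V(2,1)]]
      by (intro exI[of _ "\<lambda>C. if C = B then real (card ?H) else 0"])
        (simp add: if_distrib[of "\<lambda>r. r * _"] cong: if_cong)
  next
    case False
    then obtain b e where be: "b \<in> e" "e \<in> B" "b \<notin> J"
      by blast
    then obtain a where e: "e = {b, a}" and ab: "a \<noteq> b" "a \<in> V"
      using matching_obtain_partner[OF B(1)] by metis
    have bV: "b \<in> V"
      using be matching_Union[OF B(1)] by blast
    define B' where "B' = B - {{a, b}}"
    have B_eq: "B = insert {a, b} B'" and notin: "{a, b} \<notin> B'"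
      using be(2) unfolding e B'_def by (auto simp: insert_commute)
    have mB': "matching V B'"
      by (rule matching_mono[OF B(1)]) (auto simp: B'_def)
    have cB: "card B = Suc (card B')"
      using B notin by (simp add: B_eq)
    have ab_notin: "a \<notin> \<Union>B'" "b \<notin> \<Union>B'"
      using matching_eqI[OF B(1), of "{a, b}"] notin unfolding B_eq by blast+
    \<comment> \<open>\<open>T\<close> collects the partners of \<open>a\<close> interchangeable
      with \<open>b\<close>, and \<open>S\<close> those inside \<open>J\<close>; every other partner
      is already covered by \<open>B'\<close>.\<close>
    define T where "T = V - J - \<Union>B' - {a}"
    define S where "S = J - \<Union>B' - {a}"
    have T: "finite T" "b \<in> T"
      using V be bV ab ab_notin by (auto simp: T_def)
    have exchange: "F (insert {a, c} B') = F B" if c: "c \<in> T" for c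
    proof
      fix E
      \<comment> \<open>Composing the orbit sum with this transposition trades \<open>b\<close> for
        \<open>c\<close>, since it fixes \<open>a\<close>, the vertices of \<open>B'\<close> and all
        of \<open>J\<close>.\<close>
      have \<tau>: "Transposition.transpose b c permutes (V - J)"
        using c bV be by (intro permutes_swap_id) (auto simp: T_def)
      have "act (Transposition.transpose b c) B' = B'"
        using c ab_notin by (intro act_id_on) (auto simp: T_def transpose_def)
      then have "act (Transposition.transpose b c) B = insert {a, c} B'"
        using c ab by (auto simp: B_eq act_insert T_def transpose_def)
      then show "F (insert {a, c} B') E = F B E"
        unfolding F_def by (subst (2) sum_permutations_compose_right[OF \<tau>]) (simp add: act_comp)
    qed
    have partner_sum: "(\<Sum>c\<in>V - {a}. F (insert {a, c} B') E) = F B' E"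
      if E: "E \<in> small_matchings V k" for E
    proof -
      have "(\<Sum>c\<in>V - {a}. pexp V (card V) (act \<pi> (insert {a, c} B') \<union> E)) =
          pexp V (card V) (act \<pi> B' \<union> E)" if "\<pi> permutes (V - J)" for \<pi>
      proof -
        have \<pi>: "\<pi> permutes V"
          using permutes_subset[OF that] by blast
        have "\<pi> ` (V - {a}) = V - {\<pi> a}"
          using image_set_diff[OF permutes_inj[OF \<pi>]] permutes_image[OF \<pi>] by auto
        then have bij: "bij_betw \<pi> (V - {a}) (V - {\<pi> a})"
          using inj_on_subset[OF permutes_inj[OF \<pi>]] by (auto simp: bij_betw_def)
        \<comment> \<open>\<open>B'\<close> has at most \<open>k - 1\<close> edges and
          \<open>E\<close> at most \<open>k\<close>, so the left side is at most
          \<open>4 * k + 1\<close>; the hypothesis \<open>4 * k < card V\<close> is just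
          enough.\<close>
        have "2 * card (act \<pi> B' \<union> E) + 3 \<le> card V"
          using card_Un_le[of "act \<pi> B'" E] E B V cB
          by (simp add: card_act[OF \<pi>] small_matchings_def)
        then have "(\<Sum>j\<in>V - {\<pi> a}. pexp V (card V) (insert {\<pi> a, j} (act \<pi> B' \<union> E))) =
          pexp V (card V) (act \<pi> B' \<union> E)"
          using V ab permutes_in_image[OF \<pi>] by (intro sum_pexp_insert) auto
        then show ?thesis
          by (simp add: act_insert sum.reindex_bij_betw[OF bij,
                of "\<lambda>j. pexp V (card V) (insert {\<pi> a, j} (act \<pi> B' \<union> E))"])
      qed
      then show ?thesis
        unfolding F_def by (subst sum.swap) (intro sum.cong refl, auto)
    qed
    have covered: "F (insert {a, c} B') E = 0" if c: "c \<in> \<Union>B'" for c E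
    proof -
      have "\<not> matching V (insert {a, c} B')"
      proof
        assume m: "matching V (insert {a, c} B')"
        from c obtain e' where "e' \<in> B'" "c \<in> e'"
          by blast
        with m have "{a, c} = e'"
          by (elim matching_eqI[where i = c]) auto
        with \<open>e' \<in> B'\<close> ab_notin show False
          by blast
      qed
      then have "pexp V (card V) (act \<pi> (insert {a, c} B') \<union> E) = 0" if "\<pi> permutes (V - J)" for \<pi>
        using matching_act[OF permutes_subset[OF that, of V]]
        by (intro pexp_eq_0_superset[of _ "act \<pi> (insert {a, c} B')"]) auto
      then show ?thesis
        by (simp add: F_def)
    qed
    \<comment> \<open>All partners in \<open>T\<close> contribute equally, so the vertex equation
      can be solved for \<open>F B\<close>.\<close>
    have step: "F B E = 1 / card T * (F B' E - (\<Sum>j\<in>S. F (insert {a, j} B') E))"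
      if E: "E \<in> small_matchings V k" for E
    proof -
      have "F B' E = (\<Sum>c\<in>T \<union> S. F (insert {a, c} B') E)"
        unfolding partner_sum[OF E, symmetric]
      proof (intro sum.mono_neutral_right ballI covered)
        show "c \<in> \<Union>B'" if "c \<in> V - {a} - (T \<union> S)" for c
          using that unfolding T_def S_def by blast
      qed (use V in \<open>auto simp: T_def S_def\<close>)
      also have "\<dots> = (\<Sum>c\<in>T. F (insert {a, c} B') E) + (\<Sum>c\<in>S. F (insert {a, c} B') E)"
        using T finite_subset[OF V(2,1)] by (intro sum.union_disjoint) (auto simp: T_def S_def)
      also have "(\<Sum>c\<in>T. F (insert {a, c} B') E) = card T * F B E"
        by (simp add: exchange)
      finally show ?thesis
        using T card_gt_0_iff[of T] by (auto simp: field_simps)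
    qed
    have red: "reducible V k J (F B')"
      unfolding F_def
    proof (rule less.hyps)
      show "card (\<Union>B' - J) < card (\<Union>B - J)"
        using be finU ab_notin by (intro psubset_card_mono) (auto simp: B_eq)
      show "B' \<in> small_matchings V k"
        using mB' B cB by (simp add: small_matchings_def)
    qed
    \<comment> \<open>Here \<open>j\<close>, inside \<open>J\<close>, takes the place of
      \<open>b\<close>: fewer vertices lie outside \<open>J\<close>, with no more edges than in
      \<open>B\<close>.\<close>
    have red_insert: "reducible V k J (F (insert {a, j} B'))" if j: "j \<in> S" for j
      unfolding F_def
    proof (rule less.hyps)
      have "\<Union>(insert {a, j} B') - J \<subseteq> (\<Union>B - J) - {b}"
        using j ab ab_notin by (auto simp: S_def B_eq)
      moreover have "b \<in> \<Union>B - J"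
        using be by blast
      ultimately show "card (\<Union>(insert {a, j} B') - J) < card (\<Union>B - J)"
        using finU by (intro psubset_card_mono) auto
      have "matching V (insert {a, j} B')"
        using j V ab ab_notin by (intro matching_insert[OF mB']) (auto simp: S_def)
      then show "insert {a, j} B' \<in> small_matchings V k"
        using B cB card_insert_le_m1[of "Suc (card B')" B' "{a, j}"]
        by (simp add: small_matchings_def)
    qed
    have "reducible V k J (\<lambda>E. 1 / card T * (F B' E - (\<Sum>j\<in>S. F (insert {a, j} B') E)))"
      by (intro reducible_scale reducible_diff reducible_sum red red_insert)
    then have "reducible V k J (F B)"
      by (rule reducible_cong) (simp add: step)
    then show ?thesis
      by (simp add: F_def)
  qed
qed

text \<open>For averages over the permutations fixing the vertices of \<open>A\<close>, the orbit
  sums reduce to matchings on these vertices, first in one argument of the form and then in the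
  other. What remains is the form of \<open>psd_on_pexp\<close>.\<close>

lemma psd_on_pexp_small_matchings:
  assumes V: "finite V" "4 * k < card V"
  shows "psd_on (small_matchings V k) (\<lambda>A B. pexp V (card V) (A \<union> B))"
proof (rule psd_on_of_stabilizer_averages[where r = act and H = "\<lambda>A. {\<pi>. \<pi> permutes (V - \<Union>A)}"])
  let ?X = "small_matchings V k"
  show "finite ?X"
    by (rule finite_small_matchings[OF V(1)])
  fix A :: "'a set set" and v :: "'a set set \<Rightarrow> real"
  assume A: "A \<in> ?X"
  let ?J = "\<Union>A"
  let ?H = "{\<pi>. \<pi> permutes (V - ?J)}"
  let ?Y = "small_matchings ?J k"
  \<comment> \<open>\<open>card ?J \<le> 2 * k\<close>, so \<open>4 * k < card V\<close> yields the
    size condition of \<open>psd_on_pexp\<close>.\<close>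
  have J: "?J \<subseteq> V" "finite ?J" "2 * card ?J \<le> card V"
    using A V matching_Union[of V A] finite_subset[of ?J V] card_Union_matching[of V A]
    by (auto simp: small_matchings_def)
  have perm: "\<pi> permutes V" if "\<pi> \<in> ?H" for \<pi>
    using permutes_subset[of \<pi> "V - ?J" V] that by auto
  define w where "w = (\<lambda>B. \<Sum>\<pi>\<in>?H. v (act \<pi> B))"
  define L where "L = (\<lambda>E. \<Sum>B\<in>?X. v B * (\<Sum>\<pi>\<in>?H. pexp V (card V) (act \<pi> B \<union> E)))"
  \<comment> \<open>Reindexing \<open>B\<close> by \<open>\<pi>\<close> and passing to inverses
    moves the averaging from the coefficients \<open>v\<close> to the moments.\<close>
  have L: "(\<Sum>B\<in>?X. w B * pexp V (card V) (B \<union> E)) = L E" for E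
  proof -
    have "(\<Sum>B\<in>?X. w B * pexp V (card V) (B \<union> E)) =
        (\<Sum>\<pi>\<in>?H. \<Sum>B\<in>?X. v (act \<pi> B) * pexp V (card V) (B \<union> E))"
      unfolding w_def sum_distrib_right by (rule sum.swap)
    also have "\<dots> = (\<Sum>\<pi>\<in>?H. \<Sum>B\<in>?X. v B * pexp V (card V) (act (inv \<pi>) B \<union> E))"
    proof (rule sum.cong[OF refl])
      fix \<pi>
      assume "\<pi> \<in> ?H"
      then have \<pi>: "\<pi> permutes V"
        by (rule perm)
      show "(\<Sum>B\<in>?X. v (act \<pi> B) * pexp V (card V) (B \<union> E)) =
          (\<Sum>B\<in>?X. v B * pexp V (card V) (act (inv \<pi>) B \<union> E))"
        by (subst (2) sum.reindex_bij_betw[OF bij_betw_act_small_matchings[OF \<pi>], symmetric])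
          (simp add: act_inv_act[OF \<pi>])
    qed
    also have "\<dots> = (\<Sum>\<pi>\<in>?H. \<Sum>B\<in>?X. v B * pexp V (card V) (act \<pi> B \<union> E))"
      by (rule sum_permutations_inverse[symmetric])
    also have "\<dots> = L E"
      unfolding L_def sum_distrib_left by (rule sum.swap)
    finally show ?thesis .
  qed
  have "reducible V k ?J L"
    unfolding L_def
    by (intro reducible_sum reducible_scale reducible_sum_act V J)
  then obtain c where c: "\<And>E. E \<in> ?X \<Longrightarrow> L E = (\<Sum>C\<in>?Y. c C * pexp V (card V) (C \<union> E))"
    unfolding reducible_def by blast
  have "(\<Sum>B\<in>?X. \<Sum>E\<in>?X. w B * w E * pexp V (card V) (B \<union> E)) = (\<Sum>E\<in>?X. w E * L E)"
    unfolding L[symmetric] sum_distrib_left by (subst sum.swap) (simp add: mult_ac)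
  also have "\<dots> = (\<Sum>E\<in>?X. w E * (\<Sum>C\<in>?Y. c C * pexp V (card V) (C \<union> E)))"
    by (simp add: c)
  also have "\<dots> = (\<Sum>C\<in>?Y. c C * (\<Sum>E\<in>?X. w E * pexp V (card V) (E \<union> C)))"
    unfolding sum_distrib_left by (subst sum.swap) (simp add: mult_ac Un_commute)
  \<comment> \<open>Second use of the reduction: a \<open>C\<close> inside \<open>?J\<close> is
    itself an index in \<open>?X\<close>, so the inner sum is \<open>L C\<close>.\<close>
  also have "\<dots> = (\<Sum>C\<in>?Y. c C * (\<Sum>D\<in>?Y. c D * pexp V (card V) (D \<union> C)))"
    using c small_matchings_mono[OF J(1), of k] by (simp add: L subset_iff)
  also have "\<dots> = (\<Sum>C\<in>?Y. \<Sum>D\<in>?Y. c C * c D * pexp ?J (card V) (C \<union> D))"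
    unfolding sum_distrib_left
  proof (intro sum.cong refl)
    fix C D
    assume CD: "C \<in> ?Y" "D \<in> ?Y"
    then have "\<Union>(D \<union> C) \<subseteq> ?J"
      using matching_Union[of ?J C] matching_Union[of ?J D] by (auto simp: small_matchings_def)
    then have "matching ?J (D \<union> C) \<longleftrightarrow> matching V (D \<union> C)"
      using matching_Int[of V ?J "D \<union> C"] J by (simp add: Int_absorb1)
    then show "c C * (c D * pexp V (card V) (D \<union> C)) = c C * c D * pexp ?J (card V) (C \<union> D)"
      by (simp add: pexp_def Un_commute)
  qed
  finally show "0 \<le> (\<Sum>a\<in>?X. \<Sum>b\<in>?X. (\<Sum>\<pi>\<in>?H. v (act \<pi> a)) * (\<Sum>\<pi>\<in>?H. v (act \<pi> b)) *
      pexp V (card V) (a \<union> b))"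
    using psd_onD[OF psd_on_pexp[OF J(2,3) finite_small_matchings[OF J(2)]]] by (simp add: w_def)
next
  fix A :: "'a set set" and \<pi>
  assume "\<pi> \<in> {\<pi>. \<pi> permutes (V - \<Union>A)}"
  then have \<pi>: "\<pi> permutes (V - \<Union>A)" "\<pi> permutes V"
    using permutes_subset[of \<pi> "V - \<Union>A" V] by auto
  show "bij_betw (act \<pi>) (small_matchings V k) (small_matchings V k)"
    by (rule bij_betw_act_small_matchings[OF \<pi>(2)])
  show "act \<pi> A = A"
    using \<pi>(1) by (intro act_id_on) (auto simp: permutes_def)
  show "pexp V (card V) (act \<pi> B \<union> act \<pi> C) = pexp V (card V) (B \<union> C)" for B C
    using pexp_act[OF \<pi>(2), of "card V" "B \<union> C"] by (simp add: act_Un)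
qed (use V in \<open>auto simp: Un_commute finite_permutations intro: permutes_id\<close>)

subsection \<open>The pseudo-expectation on polynomials\<close>

definition linear_ext :: "('k \<Rightarrow> real) \<Rightarrow> ('k \<Rightarrow>\<^sub>0 real) \<Rightarrow> real" where
  "linear_ext E p = (\<Sum>m\<in>Poly_Mapping.keys p. Poly_Mapping.lookup p m * E m)"

lemma linear_ext_add: "linear_ext E (p + q) = linear_ext E p + linear_ext E q"
  unfolding linear_ext_def
  by (rule setsum_keys_plus_distrib[where f = "\<lambda>k x. x * E k"]) (auto simp: distrib_right)

lemma linear_ext_0 [simp]: "linear_ext E 0 = 0"
  by (simp add: linear_ext_def)

lemma linear_ext_uminus: "linear_ext E (- p) = - linear_ext E p"
  using linear_ext_add[of E p "- p"] by simp

lemma linear_ext_diff: "linear_ext E (p - q) = linear_ext E p - linear_ext E q"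
  using linear_ext_add[of E p "- q"] by (simp add: linear_ext_uminus)

lemma linear_ext_sum: "linear_ext E (\<Sum>i\<in>I. p i) = (\<Sum>i\<in>I. linear_ext E (p i))"
  by (induction I rule: infinite_finite_induct) (simp_all add: linear_ext_add)

lemma linear_ext_sum_list: "linear_ext E (\<Sum>x\<leftarrow>xs. p x) = (\<Sum>x\<leftarrow>xs. linear_ext E (p x))"
  by (induction xs) (simp_all add: linear_ext_add)

lemma linear_ext_single [simp]: "linear_ext E (Poly_Mapping.single m c) = c * E m"
  by (simp add: linear_ext_def)

lemma poly_mapping_eq_sum_single:
  "p = (\<Sum>m\<in>Poly_Mapping.keys p. Poly_Mapping.single m (Poly_Mapping.lookup p m))"
  by (rule poly_mapping_eqI)
    (auto simp: lookup_sum lookup_single when_def sum.delta in_keys_iff)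

lemma linear_ext_mult:
  fixes p q :: "'k::monoid_add \<Rightarrow>\<^sub>0 real"
  shows "linear_ext E (p * q) = (\<Sum>a\<in>Poly_Mapping.keys p. \<Sum>b\<in>Poly_Mapping.keys q.
    Poly_Mapping.lookup p a * Poly_Mapping.lookup q b * E (a + b))"
proof -
  have "p * q = (\<Sum>a\<in>Poly_Mapping.keys p. \<Sum>b\<in>Poly_Mapping.keys q.
    Poly_Mapping.single (a + b) (Poly_Mapping.lookup p a * Poly_Mapping.lookup q b))"
    unfolding mult_single[symmetric] sum_product[symmetric]
    by (rule arg_cong2[where f = "(*)"]; rule poly_mapping_eq_sum_single)
  then show ?thesis
    by (simp add: linear_ext_sum)
qed

lemma linear_ext_mult_single:
  fixes p :: "'k::monoid_add \<Rightarrow>\<^sub>0 real"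
  shows "linear_ext E (p * Poly_Mapping.single b c) =
    (\<Sum>a\<in>Poly_Mapping.keys p. Poly_Mapping.lookup p a * (c * E (a + b)))"
  by (simp add: linear_ext_mult mult_ac)

section \<open>Monomials as edge sets, and the pseudo-expectation\<close>

lemma keys_add_nat:
  "Poly_Mapping.keys (a + b :: 'v \<Rightarrow>\<^sub>0 nat) = Poly_Mapping.keys a \<union> Poly_Mapping.keys b"
  by (auto simp: in_keys_iff lookup_add)

text \<open>Forgetting exponents builds the Boolean equations into the functional; forgetting the
  order in a pair gives the unordered edge.\<close>

definition edge_set :: "('a \<times> 'a \<Rightarrow>\<^sub>0 nat) \<Rightarrow> 'a set set" where
  "edge_set m = (\<lambda>(i, j). {i, j}) ` Poly_Mapping.keys m"

lemma edge_set_0 [simp]: "edge_set 0 = {}"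
  by (simp add: edge_set_def)

lemma edge_set_add: "edge_set (a + b) = edge_set a \<union> edge_set b"
  by (simp add: edge_set_def keys_add_nat image_Un)

lemma card_edge_set_le_mdeg: "card (edge_set m) \<le> mdeg m"
proof -
  have "card (edge_set m) \<le> (\<Sum>v\<in>Poly_Mapping.keys m. 1)"
    unfolding edge_set_def by (simp add: card_image_le)
  also have "\<dots> \<le> mdeg m"
    unfolding mdeg_def by (intro sum_mono) (simp add: in_keys_iff Suc_le_eq)
  finally show ?thesis .
qed

lemma mdeg_le_tdeg: "m \<in> Poly_Mapping.keys p \<Longrightarrow> ereal (mdeg m) \<le> tdeg p"
  unfolding tdeg_def by (rule SUP_upper)

definition pseudo_expectation :: "nat \<Rightarrow> (nat \<times> nat) rpoly \<Rightarrow> real" where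
  "pseudo_expectation n = linear_ext (\<lambda>m. pexp {1..n} n (edge_set m))"

lemma pseudo_expectation_one: "pseudo_expectation n 1 = 1"
  unfolding single_one[symmetric] pseudo_expectation_def
  by (simp add: pexp_def pm_weight_def del: single_one)

lemma xvar_eq_single: "xvar i j = Poly_Mapping.single (Poly_Mapping.single (min i j, max i j) 1) 1"
  by (simp add: xvar_def Var_def)

lemma edge_set_xvar: "edge_set (Poly_Mapping.single (min i j, max i j) 1) = {{i, j :: nat}}"
  by (auto simp: edge_set_def min_def max_def)

lemma pseudo_expectation_boolean: "pseudo_expectation n (f * (xvar i j ^ 2 - xvar i j)) = 0"
  unfolding pseudo_expectation_def xvar_eq_single
  by (simp add: right_diff_distrib linear_ext_diff power2_eq_square mult_single
      linear_ext_mult_single edge_set_add)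

text \<open>Monomial by monomial this is \<open>sum_pexp_insert\<close>, as an edge set is no larger
  than the degree.\<close>

lemma pseudo_expectation_vertex:
  assumes i: "i \<in> {1..n}" and deg: "\<And>m. m \<in> Poly_Mapping.keys f \<Longrightarrow> 2 * mdeg m + 3 \<le> n"
  shows "pseudo_expectation n (f * ((\<Sum>j\<in>{1..n} - {i}. xvar i j) - 1)) = 0"
proof -
  let ?E = "\<lambda>m. pexp {1..n} n (edge_set m)"
  have "pseudo_expectation n (f * ((\<Sum>j\<in>{1..n} - {i}. xvar i j) - Poly_Mapping.single 0 1)) =
    (\<Sum>j\<in>{1..n} - {i}. \<Sum>m\<in>Poly_Mapping.keys f.
        Poly_Mapping.lookup f m * pexp {1..n} n (insert {i, j} (edge_set m))) -
    (\<Sum>m\<in>Poly_Mapping.keys f. Poly_Mapping.lookup f m * ?E m)"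
    unfolding pseudo_expectation_def xvar_eq_single
    by (simp add: right_diff_distrib linear_ext_diff sum_distrib_left linear_ext_sum
        linear_ext_mult_single edge_set_add edge_set_xvar[unfolded One_nat_def] del: single_one)
  also have "\<dots> = (\<Sum>m\<in>Poly_Mapping.keys f. Poly_Mapping.lookup f m *
      ((\<Sum>j\<in>{1..n} - {i}. pexp {1..n} n (insert {i, j} (edge_set m))) - ?E m))"
    by (subst sum.swap) (simp add: right_diff_distrib sum_subtractf sum_distrib_left)
  also have "\<dots> = 0"
  proof (rule sum.neutral, rule ballI)
    fix m
    assume "m \<in> Poly_Mapping.keys f"
    then have "2 * card (edge_set m) + 3 \<le> card {1..n}"
      using deg card_edge_set_le_mdeg[of m] by fastforce
    then show "Poly_Mapping.lookup f m *
      ((\<Sum>j\<in>{1..n} - {i}. pexp {1..n} n (insert {i, j} (edge_set m))) - ?E m) = 0"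
      using sum_pexp_insert[of "{1..n}" i "edge_set m"] i by simp
  qed
  finally show ?thesis
    by simp
qed

lemma pseudo_expectation_square_nonneg:
  assumes "0 < n" and deg: "\<And>m. m \<in> Poly_Mapping.keys g \<Longrightarrow> 4 * mdeg m < n"
  shows "0 \<le> pseudo_expectation n (g ^ 2)"
proof -
  define k where "k = (n - 1) div 4"
  \<comment> \<open>A monomial whose edge set is no matching contributes nothing: the moments of all
    its multiples vanish.\<close>
  define S where "S = {m \<in> Poly_Mapping.keys g. matching {1..n} (edge_set m)}"
  let ?X = "small_matchings {1..n} k"
  let ?E = "\<lambda>A B. pexp {1..n} n (A \<union> B)"
  have "psd_on ?X ?E"
    using psd_on_pexp_small_matchings[of "{1..n}" k] \<open>0 < n\<close> by (simp add: k_def)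
  moreover have "edge_set ` S \<subseteq> ?X"
    using deg card_edge_set_le_mdeg
    by (fastforce simp: S_def small_matchings_def k_def intro: order_trans)
  ultimately have "psd_on S (\<lambda>a b. ?E (edge_set a) (edge_set b))"
    by (intro psd_on_vimage[where X = ?X and f = edge_set and K = ?E] finite_small_matchings)
      (auto simp: S_def)
  moreover have "pseudo_expectation n (g ^ 2) = (\<Sum>a\<in>S. \<Sum>b\<in>S.
      Poly_Mapping.lookup g a * Poly_Mapping.lookup g b * ?E (edge_set a) (edge_set b))"
    unfolding power2_eq_square pseudo_expectation_def linear_ext_mult edge_set_add S_def
  proof (intro sum.mono_neutral_cong_right refl ballI)
    show "(\<Sum>b\<in>Poly_Mapping.keys g. Poly_Mapping.lookup g a * Poly_Mapping.lookup g b *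
        ?E (edge_set a) (edge_set b)) = 0"
      if "a \<in> Poly_Mapping.keys g - {m \<in> Poly_Mapping.keys g. matching {1..n} (edge_set m)}" for a
      using that by (auto simp: pexp_eq_0_superset intro!: sum.neutral)
  qed (auto simp: pexp_eq_0_superset)
  ultimately show ?thesis
    by (simp add: psd_onD)
qed

text \<open>Turns the bound on the sum of the two degrees into one on the multiplier alone. For
  \<open>2 \<le> n\<close> some variable occurs in the equation.\<close>

lemma tdeg_vertex_equation:
  assumes "2 \<le> n" "i \<in> {1..n}"
  shows "1 \<le> tdeg ((\<Sum>j\<in>{1..n} - {i}. xvar i j) - 1)"
proof -
  obtain j where j: "j \<in> {1..n} - {i}"
    using that[of 1] that[of 2] assms by (cases "i = 1") auto
  let ?m = "Poly_Mapping.single (min i j, max i j) (1::nat)"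
  \<comment> \<open>Distinct \<open>j'\<close> name distinct variables at \<open>i\<close>, so in
    the sum the coefficient of \<open>?m\<close> comes from \<open>j\<close> alone.\<close>
  have "Poly_Mapping.lookup (xvar i j') ?m = (if j' = j then 1 else 0)" if "j' \<noteq> i" for j'
  proof -
    have "(min i j', max i j') = (min i j, max i j) \<longleftrightarrow> j' = j"
      using that j by (auto simp: min_def max_def split: if_splits)
    moreover have "Poly_Mapping.single u (1::nat) = Poly_Mapping.single v 1 \<longleftrightarrow> u = v"
      for u v :: "nat \<times> nat"
      by (metis keys_single one_neq_zero singleton_inject)
    ultimately show ?thesis
      by (simp only: xvar_eq_single lookup_single when_def)
  qed
  moreover have "?m \<noteq> 0"
    by (metis keys_single keys_zero insert_not_empty one_neq_zero)
  ultimately have "Poly_Mapping.lookup ((\<Sum>j\<in>{1..n} - {i}. xvar i j) - 1) ?m = 1"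
    using j by (simp add: lookup_minus lookup_sum lookup_one when_def)
  then have "?m \<in> Poly_Mapping.keys ((\<Sum>j\<in>{1..n} - {i}. xvar i j) - 1)"
    by (simp add: in_keys_iff)
  from mdeg_le_tdeg[OF this] show ?thesis
    by (simp add: mdeg_def one_ereal_def)
qed

theorem mainTheorem1:
  fixes n :: nat
  assumes "n \<ge> 2"
  shows "\<not> sos_refutable (edges n) (pm_index n) (pm_eqn n) ((real n - 1) / 2)"
proof
  assume "sos_refutable (edges n) (pm_index n) (pm_eqn n) ((real n - 1) / 2)"
  then obtain f gs where
    f: "\<And>s. s \<in> pm_index n \<Longrightarrow> tdeg (f s) + tdeg (pm_eqn n s) \<le> ereal ((real n - 1) / 2)"
    and gs: "\<And>g. g \<in> set gs \<Longrightarrow> tdeg g \<le> ereal ((real n - 1) / 2 / 2)"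
    and eq: "- 1 = (\<Sum>s\<in>pm_index n. f s * pm_eqn n s) + (\<Sum>g\<leftarrow>gs. g ^ 2)"
    unfolding sos_refutable_def by blast
  have "pseudo_expectation n (f s * pm_eqn n s) = 0" if s: "s \<in> pm_index n" for s
  proof (cases s)
    case (Inl e)
    then show ?thesis
      by (cases e) (simp add: pseudo_expectation_boolean)
  next
    case (Inr i)
    then have i: "i \<in> {1..n}"
      using s by (auto simp: pm_index_def)
    have "2 * mdeg m + 3 \<le> n" if m: "m \<in> Poly_Mapping.keys (f s)" for m
    proof -
      \<comment> \<open>\<open>mdeg m + 1 \<le> (n - 1) / 2\<close> amounts to
        \<open>2 * mdeg m + 3 \<le> n\<close>.\<close>
      have "ereal (mdeg m) + 1 \<le> tdeg (f s) + tdeg (pm_eqn n s)"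
        using add_mono[OF mdeg_le_tdeg[OF m] tdeg_vertex_equation[OF assms i]] Inr by simp
      also have "\<dots> \<le> ereal ((real n - 1) / 2)"
        by (rule f[OF s])
      finally show ?thesis
        by (simp add: one_ereal_def)
    qed
    then show ?thesis
      using pseudo_expectation_vertex[OF i, of "f s"] Inr by simp
  qed
  \<comment> \<open>Applied to the refutation, the functional leaves only the squares on the right,
    while the left side becomes -1.\<close>
  then have "pseudo_expectation n (- 1) = (\<Sum>g\<leftarrow>gs. pseudo_expectation n (g ^ 2))"
    by (simp add: eq pseudo_expectation_def linear_ext_add linear_ext_sum linear_ext_sum_list)
  moreover have "0 \<le> (\<Sum>g\<leftarrow>gs. pseudo_expectation n (g ^ 2))"
  proof (rule sum_list_nonneg, clarsimp)
    fix g
    assume g: "g \<in> set gs"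
    have "4 * mdeg m < n" if m: "m \<in> Poly_Mapping.keys g" for m
      using order_trans[OF mdeg_le_tdeg[OF m] gs[OF g]] assms by simp
    then show "0 \<le> pseudo_expectation n (g ^ 2)"
      using assms by (intro pseudo_expectation_square_nonneg) auto
  qed
  moreover have "pseudo_expectation n (- 1) = - 1"
    using pseudo_expectation_one[of n] by (simp add: pseudo_expectation_def linear_ext_uminus)
  ultimately show False
    by simp
qed

end
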